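(* Let $u,v\colon\mathbb{R}^3\to\mathbb{R}$ have octonion Fourier transforms $U$ and $V$, and let $\mathcal{F}_{\mathrm{OFT}}\{u*v\}$ denote the octonion Fourier transform of the convolution $(u*v)(\mathbf{x})=\int_{\mathbb{R}^3}u(\mathbf{y})\cdot v(\mathbf{x}-\mathbf{y})\,d\mathbf{y}$. Then for all $\mathbf{f}=(f_1,f_2,f_3)\in\mathbb{R}^3$ $$\begin{aligned}\mathcal{F}_{\mathrm{OFT}}\{u*v\}(\mathbf{f})&=V(f_1,f_2,f_3)\cdot\big(U_{eee}(\mathbf{f})-U_{eeo}(\mathbf{f})\,\mathbf{e}_4\big)\\&\quad+V(f_1,-f_2,-f_3)\cdot\big(-U_{oee}(\mathbf{f})\,\mathbf{e}_1+U_{ooe}(\mathbf{f})\,\mathbf{e}_3\big)\\&\quad+V(f_1,f_2,-f_3)\cdot\big(-U_{eoe}(\mathbf{f})\,\mathbf{e}_2+U_{oeo}(\mathbf{f})\,\mathbf{e}_5\big)\\&\quad+V(-f_1,f_2,-f_3)\cdot\big(U_{eoo}(\mathbf{f})\,\mathbf{e}_6-U_{ooo}(\mathbf{f})\,\mathbf{e}_7\big),\end{aligned}$$ where $U=U_{eee}-U_{oee}\mathbf{e}_1-U_{eoe}\mathbf{e}_2+U_{ooe}\mathbf{e}_3-U_{eeo}\mathbf{e}_4+U_{oeo}\mathbf{e}_5+U_{eoo}\mathbf{e}_6-U_{ooo}\mathbf{e}_7$ is the decomposition of $U$ into its eight real-valued components of different parity.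
   Context: $\mathbb{O}$ denotes the real algebra of octonions with basis $1,\mathbf{e}_1,\dots,\mathbf{e}_7$: an octonion is a pair $(q_0,q_1)$ of quaternions (quaternion units $\mathbf{e}_1,\mathbf{e}_2,\mathbf{e}_3$ with $\mathbf{e}_1\mathbf{e}_2=\mathbf{e}_3$), with product $(q_0,q_1)\cdot(p_0,p_1)=(q_0p_0-p_1^*q_1,\;p_1q_0+q_1p_0^* )$, where $^*$ is quaternion conjugation, and $\mathbf{e}_4=(0,1)$, $\mathbf{e}_5=(0,\mathbf{e}_1)$, $\mathbf{e}_6=(0,\mathbf{e}_2)$, $\mathbf{e}_7=(0,\mathbf{e}_3)$. The product is neither commutative nor associative; products without brackets are evaluated from left to right, i.e. $abcd=((ab)c)d$. For an imaginary unit $\mathbf{e}_k$ and $\alpha\in\mathbb{R}$, $e^{\mathbf{e}_k\alpha}=\cos\alpha+\mathbf{e}_k\sin\alpha$. Integrals of octonion-valued functions are taken componentwise. The octonion Fourier transform (OFT) of a Lebesgue integrable $u\colon\mathbb{R}^3\to\mathbb{O}$ is $$U(\mathbf{f})=\int_{\mathbb{R}^3}u(\mathbf{x})\,e^{-\mathbf{e}_1 2\pi f_1x_1}\,e^{-\mathbf{e}_2 2\pi f_2x_2}\,e^{-\mathbf{e}_4 2\pi f_3x_3}\,d\mathbf{x},\qquad \mathbf{f}=(f_1,f_2,f_3)\in\mathbb{R}^3,$$ with multiplication from left to right. For real-valued $u$ and $p,q,r\in\{e,o\}$, put $$U_{pqr}(\mathbf{f})=\int_{\mathbb{R}^3}u_{pqr}(\mathbf{x})\,c_p(2\pi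 f_1x_1)\,c_q(2\pi f_2x_2)\,c_r(2\pi f_3x_3)\,d\mathbf{x},\qquad c_e=\cos,\ c_o=\sin,$$ where $u_{pqr}$ is the component of $u$ that is even ($e$) or odd ($o$) in $x_1,x_2,x_3$ respectively: $$u_{pqr}(x_1,x_2,x_3)=\tfrac18\sum_{s_1,s_2,s_3\in\{1,-1\}}\varepsilon_p(s_1)\,\varepsilon_q(s_2)\,\varepsilon_r(s_3)\,u(s_1x_1,s_2x_2,s_3x_3),$$ with $\varepsilon_e(s)=1$ and $\varepsilon_o(s)=s$. Standing assumption: $u$ and $v$ are real-valued and Lebesgue integrable, so that their OFTs are well defined. *)

theory Defs
  imports "HOL-Analysis.Analysis"
begin

datatype quat = Quat (qre: real) (qim1: real) (qim2: real) (qim3: real)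

instantiation quat :: "{ring_1, real_vector}"
begin

definition "0 = Quat 0 0 0 0"

definition "1 = Quat 1 0 0 0"

definition "p + q = Quat (qre p + qre q) (qim1 p + qim1 q) (qim2 p + qim2 q) (qim3 p + qim3 q)"

definition "- q = Quat (- qre q) (- qim1 q) (- qim2 q) (- qim3 q)"

definition "p - q = Quat (qre p - qre q) (qim1 p - qim1 q) (qim2 p - qim2 q) (qim3 p - qim3 q)"

definition "r *\<^sub>R q = Quat (r * qre q) (r * qim1 q) (r * qim2 q) (r * qim3 q)"

definition "p * q = Quat
  (qre p * qre q - qim1 p * qim1 q - qim2 p * qim2 q - qim3 p * qim3 q)
  (qre p * qim1 q + qim1 p * qre q + qim2 p * qim3 q - qim3 p * qim2 q)
  (qre p * qim2 q - qim1 p * qim3 q + qim2 p * qre q + qim3 p * qim1 q)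
  (qre p * qim3 q + qim1 p * qim2 q - qim2 p * qim1 q + qim3 p * qre q)"

instance
  by standard
    (simp_all add: zero_quat_def one_quat_def plus_quat_def uminus_quat_def minus_quat_def
      scaleR_quat_def times_quat_def algebra_simps)

end

instance quat :: real_algebra_1
  by standard (simp_all add: scaleR_quat_def times_quat_def algebra_simps)

definition qcnj :: "quat \<Rightarrow> quat" where
  "qcnj q = Quat (qre q) (- qim1 q) (- qim2 q) (- qim3 q)"


text \<open>The product is not associative, so there is no ring instance. As \<open>*\<close> associates
  to the left, unbracketed products are evaluated from left to right.
  This is the Cayley-Dickson convention with \<open>e\<^sub>1 e\<^sub>4 = e\<^sub>5\<close>, \<open>e\<^sub>2 e\<^sub>4 = e\<^sub>6\<close>, \<open>e\<^sub>3 e\<^sub>4 = e\<^sub>7\<close>.\<close>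

datatype octonion = Octonion (ofst: quat) (osnd: quat)

instantiation octonion :: "{real_vector, one, times}"
begin

definition "0 = Octonion 0 0"

definition "1 = Octonion 1 0"

definition "a + b = Octonion (ofst a + ofst b) (osnd a + osnd b)"

definition "- a = Octonion (- ofst a) (- osnd a)"

definition "a - b = Octonion (ofst a - ofst b) (osnd a - osnd b)"

definition "r *\<^sub>R a = Octonion (r *\<^sub>R ofst a) (r *\<^sub>R osnd a)"

definition "a * b = Octonion
  (ofst a * ofst b - qcnj (osnd b) * osnd a)
  (osnd b * ofst a + osnd a * qcnj (ofst b))"

instance
  by standard
    (simp_all add: zero_octonion_def plus_octonion_def uminus_octonion_def minus_octonion_def
      scaleR_octonion_def algebra_simps)

end

definition oct_e1 :: octonion (\<open>\<e>\<^sub>1\<close>) where "\<e>\<^sub>1 = Octonion (Quat 0 1 0 0) 0"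
definition oct_e2 :: octonion (\<open>\<e>\<^sub>2\<close>) where "\<e>\<^sub>2 = Octonion (Quat 0 0 1 0) 0"
definition oct_e3 :: octonion (\<open>\<e>\<^sub>3\<close>) where "\<e>\<^sub>3 = Octonion (Quat 0 0 0 1) 0"
definition oct_e4 :: octonion (\<open>\<e>\<^sub>4\<close>) where "\<e>\<^sub>4 = Octonion 0 1"
definition oct_e5 :: octonion (\<open>\<e>\<^sub>5\<close>) where "\<e>\<^sub>5 = Octonion 0 (Quat 0 1 0 0)"
definition oct_e6 :: octonion (\<open>\<e>\<^sub>6\<close>) where "\<e>\<^sub>6 = Octonion 0 (Quat 0 0 1 0)"
definition oct_e7 :: octonion (\<open>\<e>\<^sub>7\<close>) where "\<e>\<^sub>7 = Octonion 0 (Quat 0 0 0 1)"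

text \<open>\<^const>\<open>of_real\<close> needs an associative algebra.\<close>

definition oct_of_real :: "real \<Rightarrow> octonion" where
  "oct_of_real r = r *\<^sub>R 1"

text \<open>The exponential of \<open>\<alpha> e\<close>, for an imaginary unit \<open>e\<close> only.\<close>

definition oct_cis :: "octonion \<Rightarrow> real \<Rightarrow> octonion" where
  "oct_cis e \<alpha> = oct_of_real (cos \<alpha>) + sin \<alpha> *\<^sub>R e"

definition oct_integral :: "'a measure \<Rightarrow> ('a \<Rightarrow> octonion) \<Rightarrow> octonion" where
  "oct_integral M g = Octonion
    (Quat (LINT x|M. qre (ofst (g x))) (LINT x|M. qim1 (ofst (g x)))
          (LINT x|M. qim2 (ofst (g x))) (LINT x|M. qim3 (ofst (g x))))
    (Quat (LINT x|M. qre (osnd (g x))) (LINT x|M. qim1 (osnd (g x)))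
          (LINT x|M. qim2 (osnd (g x))) (LINT x|M. qim3 (osnd (g x))))"


definition oft :: "(real^3 \<Rightarrow> octonion) \<Rightarrow> real^3 \<Rightarrow> octonion" where
  "oft u f = oct_integral lebesgue (\<lambda>x.
     u x * oct_cis \<e>\<^sub>1 (- (2 * pi * f $ 1 * x $ 1))
         * oct_cis \<e>\<^sub>2 (- (2 * pi * f $ 2 * x $ 2))
         * oct_cis \<e>\<^sub>4 (- (2 * pi * f $ 3 * x $ 3)))"

definition convolution :: "(real^3 \<Rightarrow> real) \<Rightarrow> (real^3 \<Rightarrow> real) \<Rightarrow> real^3 \<Rightarrow> real" where
  "convolution u v x = (LINT y|lebesgue. u y * v (x - y))"

text \<open>Parity with respect to one variable; three parities refer to \<open>x\<^sub>1\<close>, \<open>x\<^sub>2\<close>, \<open>x\<^sub>3\<close> in order.\<close>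

datatype parity = Even | Odd

fun parity_sign :: "parity \<Rightarrow> real \<Rightarrow> real" where
  "parity_sign Even s = 1"
| "parity_sign Odd s = s"

fun parity_trig :: "parity \<Rightarrow> real \<Rightarrow> real" where
  "parity_trig Even t = cos t"
| "parity_trig Odd t = sin t"

definition parity_part :: "parity \<Rightarrow> parity \<Rightarrow> parity \<Rightarrow> (real^3 \<Rightarrow> real) \<Rightarrow> real^3 \<Rightarrow> real" where
  "parity_part p q r u x = (1/8) * (\<Sum>s1\<in>{1,-1}. \<Sum>s2\<in>{1,-1}. \<Sum>s3\<in>{1,-1}.
     parity_sign p s1 * parity_sign q s2 * parity_sign r s3 *
     u (vector [s1 * x $ 1, s2 * x $ 2, s3 * x $ 3]))"

definition oft_part :: "parity \<Rightarrow> parity \<Rightarrow> parity \<Rightarrow> (real^3 \<Rightarrow> real) \<Rightarrow> real^3 \<Rightarrow> real" where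
  "oft_part p q r u f = (LINT x|lebesgue. parity_part p q r u x *
     parity_trig p (2 * pi * f $ 1 * x $ 1) *
     parity_trig q (2 * pi * f $ 2 * x $ 2) *
     parity_trig r (2 * pi * f $ 3 * x $ 3))"

definition has_parity :: "parity \<Rightarrow> parity \<Rightarrow> parity \<Rightarrow> (real^3 \<Rightarrow> real) \<Rightarrow> bool" where
  "has_parity p q r g \<longleftrightarrow> (\<forall>x. \<forall>s1\<in>{1,-1}. \<forall>s2\<in>{1,-1}. \<forall>s3\<in>{1,-1}.
     g (vector [s1 * x $ 1, s2 * x $ 2, s3 * x $ 3]) =
     parity_sign p s1 * parity_sign q s2 * parity_sign r s3 * g x)"

end

theory Submission
  imports Defs
begin

text \<open>
  For real \<open>u\<close>, expanding the three exponentials of the transform turns its kernel into a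
  signed combination of the eight functions \<open>c\<^sub>p c\<^sub>q c\<^sub>r\<close>, each a product of three cosines or
  sines, one for each basis unit of the octonions. The octonion coordinates of \<open>U\<close> are thus,
  up to sign, the real integrals of \<open>u c\<^sub>p c\<^sub>q c\<^sub>r\<close>, called \<open>parity_transform\<close> below.
  They agree with the integrals in which \<open>u\<close> is replaced by its parity component
  (\<open>oft_part_eq_parity_transform\<close>): every reflection of the coordinates preserves
  Lebesgue measure and multiplies \<open>c\<^sub>p c\<^sub>q c\<^sub>r\<close> by precisely the sign with which the reflected
  \<open>u\<close> enters the parity component. Since frequency and position occur in the kernel only
  through the products \<open>f\<^sub>i x\<^sub>i\<close>, the same rule gives the parity of the transforms in the
  frequency.

  The integral of \<open>u * v\<close> against a bounded function \<open>\<phi>\<close> is the double integral of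
  \<open>u(y) v(z) \<phi>(y + z)\<close> (\<open>integral_convolution_mult\<close>, by Fubini). With
  \<open>\<phi> = c\<^sub>p c\<^sub>q c\<^sub>r\<close>, the addition theorems in the three coordinates separate \<open>y\<close> from \<open>z\<close>,
  so each parity transform of \<open>u * v\<close> is a signed sum of eight products of a parity
  transform of \<open>u\<close> with one of \<open>v\<close> (\<open>parity_transform_convolution\<close>). What is
  left is an identity between bilinear expressions in the
  sixteen real transforms of \<open>u\<close> and \<open>v\<close>.

  The sign changes in the arguments of \<open>V\<close> express the failure of commutativity. The addition
  theorem produces a unit such as \<open>\<e>\<^sub>1\<close> next to the first exponential, and this unit has to be
  moved to the far right, past the exponentials in \<open>\<e>\<^sub>2\<close> and \<open>\<e>\<^sub>4\<close>. As \<open>\<e>\<^sub>1\<close> anticommutes with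
  both of these, their angles change sign, which replaces \<open>f\<^sub>2\<close> and \<open>f\<^sub>3\<close> by their negatives.
  For products of several units associativity fails as well, and there the signs come from the
  multiplication table. By the parity of the transforms of \<open>v\<close>, evaluating \<open>V\<close> at
  a reflected frequency just changes the signs of some of its coordinates at \<open>f\<close>, so
  the identity can be compared coordinate by coordinate.
\<close>

section \<open>Reflections and the parity components\<close>

definition parity_kernel ::
    "parity \<Rightarrow> parity \<Rightarrow> parity \<Rightarrow> real^3 \<Rightarrow> real^3 \<Rightarrow> real" where
  "parity_kernel p q r f x =
     parity_trig p (2 * pi * f $ 1 * x $ 1) *
     parity_trig q (2 * pi * f $ 2 * x $ 2) *
     parity_trig r (2 * pi * f $ 3 * x $ 3)"

definition parity_transform ::
    "parity \<Rightarrow> parity \<Rightarrow> parity \<Rightarrow> (real^3 \<Rightarrow> real) \<Rightarrow> real^3 \<Rightarrow> real" where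
  "parity_transform p q r u f = (LINT x|lebesgue. u x * parity_kernel p q r f x)"

lemma parity_trig_sign:
  assumes "s \<in> {1, -1}"
  shows "parity_trig p (s * t) = parity_sign p s * parity_trig p t"
  using assms by (cases p) auto

lemma abs_parity_trig_le: "\<bar>parity_trig p t\<bar> \<le> 1"
  by (cases p) auto

lemma borel_measurable_parity_trig [measurable]: "parity_trig p \<in> borel_measurable borel"
proof -
  have "parity_trig p = cos \<or> parity_trig p = sin"
    by (cases p) auto
  then show ?thesis by auto
qed

lemma borel_measurable_parity_kernel [measurable]:
  "parity_kernel p q r f \<in> borel_measurable borel"
  unfolding parity_kernel_def[abs_def] by measurable

lemma abs_parity_kernel_le: "\<bar>parity_kernel p q r f x\<bar> \<le> 1"
  unfolding parity_kernel_def abs_mult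
  by (intro mult_le_one abs_parity_trig_le mult_nonneg_nonneg abs_ge_zero)

text \<open>This symmetry between frequency and position transfers the reflection rule for
  positions to frequencies.\<close>

lemma parity_kernel_commute: "parity_kernel p q r f x = parity_kernel p q r x f"
  by (simp add: parity_kernel_def mult_ac)

lemma parity_kernel_reflect:
  assumes "s1 \<in> {1, -1}" "s2 \<in> {1, -1}" "s3 \<in> {1, -1}"
  shows "parity_kernel p q r f (vector [s1 * x $ 1, s2 * x $ 2, s3 * x $ 3]) =
         parity_sign p s1 * parity_sign q s2 * parity_sign r s3 * parity_kernel p q r f x"
  using parity_trig_sign[OF assms(1), of p "2 * pi * f $ 1 * x $ 1"]
    parity_trig_sign[OF assms(2), of q "2 * pi * f $ 2 * x $ 2"]
    parity_trig_sign[OF assms(3), of r "2 * pi * f $ 3 * x $ 3"]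
  by (simp add: parity_kernel_def mult_ac)

lemma has_parity_parity_transform: "has_parity p q r (parity_transform p q r u)"
  unfolding has_parity_def
proof (intro allI ballI)
  fix f :: "real^3" and s1 s2 s3 :: real
  assume s: "s1 \<in> {1, -1}" "s2 \<in> {1, -1}" "s3 \<in> {1, -1}"
  let ?c = "parity_sign p s1 * parity_sign q s2 * parity_sign r s3"
  have "parity_transform p q r u (vector [s1 * f $ 1, s2 * f $ 2, s3 * f $ 3]) =
      (LINT x|lebesgue. ?c * (u x * parity_kernel p q r f x))"
    unfolding parity_transform_def
    by (subst parity_kernel_commute, subst parity_kernel_reflect[OF s],
        subst parity_kernel_commute) (simp add: mult_ac)
  also have "\<dots> = ?c * parity_transform p q r u f"
    unfolding parity_transform_def by (rule integral_mult_right_zero)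
  finally show "parity_transform p q r u (vector [s1 * f $ 1, s2 * f $ 2, s3 * f $ 3]) =
      ?c * parity_transform p q r u f" .
qed

lemma integrable_bounded_mult:
  fixes u \<phi> :: "'a::euclidean_space \<Rightarrow> real"
  assumes u: "integrable lebesgue u" and \<phi>: "\<phi> \<in> borel_measurable borel"
    and B: "\<And>x. \<bar>\<phi> x\<bar> \<le> B"
  shows "integrable lebesgue (\<lambda>x. u x * \<phi> x)"
proof (rule Bochner_Integration.integrable_bound)
  show "integrable lebesgue (\<lambda>x. B * u x)"
    using u by simp
  show "(\<lambda>x. u x * \<phi> x) \<in> borel_measurable lebesgue"
    using borel_measurable_integrable[OF u] measurable_completion[of \<phi> lborel borel] \<phi>
    by (intro borel_measurable_times) auto
  have "\<bar>u x\<bar> * \<bar>\<phi> x\<bar> \<le> \<bar>B\<bar> * \<bar>u x\<bar>" for x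
    using B[of x] by (subst mult.commute, intro mult_right_mono) auto
  then show "AE x in lebesgue. norm (u x * \<phi> x) \<le> norm (B * u x)"
    by (auto simp: abs_mult)
qed

lemma integrable_mult_parity_kernel:
  "integrable lebesgue u \<Longrightarrow> integrable lebesgue (\<lambda>x. u x * parity_kernel p q r f x)"
  by (rule integrable_bounded_mult[OF _ _ abs_parity_kernel_le]) auto

text \<open>A reflection is an affine map that is diagonal in the standard basis with all
  factors \<open>\<plusminus>1\<close>, so the product of their absolute values, the Jacobian, is \<open>1\<close>.\<close>

lemma
  assumes s: "s1 \<in> {1, -1}" "s2 \<in> {1, -1}" "s3 \<in> {1, -1::real}"
  shows distr_lebesgue_reflection:
      "distr lebesgue lebesgue
         (\<lambda>x::real^3. vector [s1 * x $ 1, s2 * x $ 2, s3 * x $ 3] :: real^3) = lebesgue"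
    and measurable_reflection:
      "(\<lambda>x::real^3. vector [s1 * x $ 1, s2 * x $ 2, s3 * x $ 3] :: real^3)
        \<in> lebesgue \<rightarrow>\<^sub>M lebesgue"
proof -
  let ?S = "vector [s1, s2, s3] :: real^3"
  let ?R = "\<lambda>x::real^3. vector [s1 * x $ 1, s2 * x $ 2, s3 * x $ 3] :: real^3"
  let ?T = "\<lambda>x::real^3. 0 + (\<Sum>j\<in>Basis. ((?S \<bullet> j) * (x \<bullet> j)) *\<^sub>R j)"
  have abs1: "\<bar>?S \<bullet> j\<bar> = 1" if "j \<in> Basis" for j
  proof -
    obtain i where j: "j = axis i 1"
      using \<open>j \<in> Basis\<close> by (auto simp: Basis_vec_def)
    show ?thesis
      using s exhaust_3[of i] by (auto simp: j inner_axis vector_3)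
  qed
  then have nz: "?S \<bullet> j \<noteq> 0" if "j \<in> Basis" for j
    using that by fastforce
  have "?T = ?R"
  proof
    fix x :: "real^3"
    show "?T x = ?R x"
    proof (subst euclidean_eq_iff, intro ballI)
      fix b :: "real^3" assume b: "b \<in> Basis"
      then obtain i where i: "b = axis i 1"
        by (auto simp: Basis_vec_def)
      have "?T x \<bullet> b = (?S \<bullet> b) * (x \<bullet> b)"
        using b by simp
      also have "\<dots> = ?R x \<bullet> b"
        using exhaust_3[of i] by (auto simp: i inner_axis vector_3)
      finally show "?T x \<bullet> b = ?R x \<bullet> b" .
    qed
  qed
  moreover have "lebesgue = density (distr lebesgue lebesgue ?T) (\<lambda>_. (\<Prod>j\<in>Basis. \<bar>?S \<bullet> j\<bar>))"
    by (rule lebesgue_affine_euclidean) (rule nz)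
  moreover have "?T \<in> lebesgue \<rightarrow>\<^sub>M lebesgue"
    by (rule lebesgue_affine_measurable) (rule nz)
  ultimately show "distr lebesgue lebesgue ?R = lebesgue" "?R \<in> lebesgue \<rightarrow>\<^sub>M lebesgue"
    by (simp_all add: abs1 density_1)
qed

text \<open>Projecting \<open>u\<close> to a parity is self-adjoint and fixes the kernel of that parity.
  Concretely, after the substitution \<open>x \<mapsto> R x\<close> each of the eight reflections \<open>R\<close> contributes
  the full transform of \<open>u\<close>, and the factor \<open>1/8\<close> averages them.\<close>

lemma oft_part_eq_parity_transform:
  assumes u: "integrable lebesgue u"
  shows "oft_part p q r u = parity_transform p q r u"
proof
  fix f :: "real^3"
  let ?K = "parity_kernel p q r f"
  let ?R = "\<lambda>s1 s2 s3 (x :: real^3). vector [s1 * x $ 1, s2 * x $ 2, s3 * x $ 3] :: real^3"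
  let ?\<sigma> = "\<lambda>s1 s2 s3. parity_sign p s1 * parity_sign q s2 * parity_sign r s3"
  let ?S = "{1, -1 :: real}"
  have refl: "has_bochner_integral lebesgue (\<lambda>x. ?\<sigma> s1 s2 s3 * u (?R s1 s2 s3 x) * ?K x)
      (parity_transform p q r u f)"
    if s: "s1 \<in> ?S" "s2 \<in> ?S" "s3 \<in> ?S" for s1 s2 s3
  proof -
    have "has_bochner_integral (distr lebesgue lebesgue (?R s1 s2 s3))
        (\<lambda>x. u x * ?K x) (parity_transform p q r u f)"
      unfolding distr_lebesgue_reflection[OF s] parity_transform_def
      using integrable_mult_parity_kernel[OF u] by (rule has_bochner_integral_integrable)
    then have "has_bochner_integral lebesgue (\<lambda>x. u (?R s1 s2 s3 x) * ?K (?R s1 s2 s3 x))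
        (parity_transform p q r u f)"
      using integrable_distr[OF measurable_reflection[OF s], of "\<lambda>x. u x * ?K x"]
        integral_distr[OF measurable_reflection[OF s]
          borel_measurable_integrable[OF integrable_mult_parity_kernel[OF u]], of p q r f]
      by (simp add: has_bochner_integral_iff)
    then show ?thesis
      unfolding parity_kernel_reflect[OF s] by (simp add: mult_ac)
  qed
  have "oft_part p q r u f = (LINT x|lebesgue. (1/8) * (\<Sum>s1\<in>?S. \<Sum>s2\<in>?S. \<Sum>s3\<in>?S.
      ?\<sigma> s1 s2 s3 * u (?R s1 s2 s3 x) * ?K x))"
    unfolding oft_part_def parity_part_def parity_kernel_def
    by (simp only: sum_distrib_right mult.assoc)
  also have "\<dots> = (1/8) * (\<Sum>s1\<in>?S. \<Sum>s2\<in>?S. \<Sum>s3\<in>?S. parity_transform p q r u f)"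
    by (intro has_bochner_integral_integral_eq has_bochner_integral_mult_right
        has_bochner_integral_sum refl)
  also have "\<dots> = parity_transform p q r u f"
    by simp
  finally show "oft_part p q r u f = parity_transform p q r u f" .
qed

section \<open>The octonion Fourier transform of a real function\<close>

text \<open>The unit belonging to the parities \<open>p\<close>, \<open>q\<close>, \<open>r\<close> is the product of those among
  \<open>\<e>\<^sub>1\<close>, \<open>\<e>\<^sub>2\<close>, \<open>\<e>\<^sub>4\<close> whose parity is odd. Each such factor brings one minus sign from the negative
  exponent, which accounts for the signs. A coordinate of the integrand is a single signed
  product, and a sign can be pulled out of an integral whether or not it converges; so
  the equation applies to a convolution before its integrability is known.\<close>

lemma oft_eq_parity_transforms:
  "oft (\<lambda>x. oct_of_real (u x)) f =
     Octonion
       (Quat (parity_transform Even Even Even u f) (- parity_transform Odd Even Even u f)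
             (- parity_transform Even Odd Even u f) (parity_transform Odd Odd Even u f))
       (Quat (- parity_transform Even Even Odd u f) (parity_transform Odd Even Odd u f)
             (parity_transform Even Odd Odd u f) (- parity_transform Odd Odd Odd u f))"
  by (simp add: oft_def oct_integral_def parity_transform_def parity_kernel_def oct_cis_def
      oct_of_real_def oct_e1_def oct_e2_def oct_e4_def qcnj_def
      times_octonion_def plus_octonion_def scaleR_octonion_def one_octonion_def
      times_quat_def plus_quat_def minus_quat_def scaleR_quat_def one_quat_def zero_quat_def
      mult_ac)

section \<open>Transforms of convolutions\<close>

text \<open>Fubini's theorem is applied to the product of two copies of \<^const>\<open>lborel\<close>. For merely
  Lebesgue measurable \<open>u\<close> and \<open>v\<close>, the integrand \<open>u y * v (x - y)\<close> need not be measurable with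
  respect to that product, since the product is not complete. Both functions are therefore
  first replaced by Borel functions that agree with them almost everywhere.\<close>

lemma integrable_lebesgue_borel_representative:
  fixes u :: "'a::euclidean_space \<Rightarrow> real"
  assumes u: "integrable lebesgue u"
  obtains u' where "u' \<in> borel_measurable borel" "integrable lborel u'"
    "AE x in lborel. u x = u' x"
proof -
  obtain u' where u': "u' \<in> borel_measurable lborel" and ae: "AE x in lborel. u x = u' x"
    using completion_ex_borel_measurable_real[OF borel_measurable_integrable[OF u]] by auto
  have "integrable lebesgue u'"
    by (rule Bochner_Integration.integrable_cong_AE_imp[OF u measurable_completion[OF u']])
      (rule AE_completion[OF ae])
  then show thesis
    using that[of u'] u' ae by (simp add: integrable_completion)
qed

lemma lborel_translation:
  fixes g :: "'a::euclidean_space \<Rightarrow> real"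
  assumes "g \<in> borel_measurable borel"
  shows integrable_lborel_translation: "integrable lborel (\<lambda>x. g (x - y)) \<longleftrightarrow> integrable lborel g"
    and integral_lborel_translation: "(LINT x|lborel. g (x - y)) = (LINT x|lborel. g x)"
  using assms integrable_distr_eq[of "(+) (- y)" lborel borel g]
    integral_distr[of "(+) (- y)" lborel borel g]
  by (simp_all add: lborel_distr_plus)

text \<open>The equation holds at every \<open>x\<close> and not just almost everywhere: for fixed \<open>x\<close> the map
  \<open>y \<mapsto> x - y\<close> preserves the measure, hence pulls the exceptional null set of the second factor
  back to a null set.\<close>

lemma convolution_cong_AE:
  assumes u: "u \<in> borel_measurable borel" and v: "v \<in> borel_measurable borel"
    and uu': "AE x in lborel. u' x = u x" and vv': "AE x in lborel. v' x = v x"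
  shows "convolution u' v' x = (LINT y|lborel. u y * v (x - y))"
proof -
  have "distr lborel borel (\<lambda>y. x - y) = lborel"
    using lborel_affine[of "-1" x] by (simp add: density_1)
  with vv' have "AE y in distr lborel borel (\<lambda>y. x - y). v' y = v y"
    by (simp only:)
  then have "AE y in lborel. v' (x - y) = v (x - y)"
    by (rule AE_distrD[rotated]) simp
  with uu' have "AE y in lborel. u' y * v' (x - y) = u y * v (x - y)"
    by eventually_elim simp
  then have ae: "AE y in lebesgue. u y * v (x - y) = u' y * v' (x - y)"
    by (intro AE_completion) (simp add: eq_commute)
  have meas: "(\<lambda>y. u y * v (x - y)) \<in> borel_measurable lborel"
    using u v by measurable
  have "convolution u' v' x = (LINT y|lebesgue. u y * v (x - y))"
    unfolding convolution_def
    using ae measurable_completion[OF meas] borel_measurable_AE[OF measurable_completion[OF meas] ae]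
    by (intro integral_cong_AE) (auto simp: eq_commute)
  then show ?thesis
    by (simp add: integral_completion[OF meas])
qed

text \<open>Exchange the order of integration and substitute \<open>x = y + z\<close> in the inner integral.
  Boundedness of \<open>\<phi>\<close> is what makes the double integral converge absolutely: it is at most
  \<open>B\<close> times the product of the \<open>L\<^sup>1\<close> norms of \<open>u\<close> and \<open>v\<close>.\<close>

lemma integral_convolution_mult:
  fixes u v \<phi> :: "real^3 \<Rightarrow> real"
  assumes u: "integrable lebesgue u" and v: "integrable lebesgue v"
    and \<phi>[measurable]: "\<phi> \<in> borel_measurable borel" and B: "\<And>x. \<bar>\<phi> x\<bar> \<le> B"
  shows "(LINT x|lebesgue. convolution u v x * \<phi> x) =
         (LINT y|lebesgue. u y * (LINT z|lebesgue. v z * \<phi> (y + z)))"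
proof -
  obtain u' where [measurable]: "u' \<in> borel_measurable borel"
    and u': "integrable lborel u'" and uu': "AE x in lborel. u x = u' x"
    using integrable_lebesgue_borel_representative[OF u] .
  obtain v' where [measurable]: "v' \<in> borel_measurable borel"
    and v': "integrable lborel v'" and vv': "AE x in lborel. v x = v' x"
    using integrable_lebesgue_borel_representative[OF v] .
  let ?F = "\<lambda>y x. u' y * v' (x - y) * \<phi> x"
  have v\<phi>: "integrable lborel (\<lambda>z. v' z * \<phi> (y + z))" for y
  proof -
    have "integrable lebesgue (\<lambda>z. v' z * \<phi> (y + z))"
      by (rule integrable_bounded_mult[where B=B]) (use v' B in \<open>auto simp: integrable_completion\<close>)
    then show ?thesis by (simp add: integrable_completion)
  qed
  have F_int: "integrable lborel (?F y)" for y
    using integrable_lborel_translation[of "\<lambda>z. v' z * \<phi> (y + z)" y] v\<phi>[of y]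
    by (simp add: mult.assoc)
  have inner: "(LINT x|lborel. ?F y x) = u' y * (LINT z|lborel. v' z * \<phi> (y + z))" for y
    using integral_lborel_translation[of "\<lambda>z. v' z * \<phi> (y + z)" y]
    by (simp add: mult.assoc)
  have F_pair: "integrable (lborel \<Otimes>\<^sub>M lborel) (case_prod ?F)"
  proof (rule lborel_pair.Fubini_integrable)
    show "case_prod ?F \<in> borel_measurable (lborel \<Otimes>\<^sub>M lborel)"
      by measurable
    show "AE y in lborel. integrable lborel (\<lambda>x. case_prod ?F (y, x))"
      using F_int by simp
    show "integrable lborel (\<lambda>y. LINT x|lborel. norm (case_prod ?F (y, x)))"
    proof (rule Bochner_Integration.integrable_bound)
      let ?C = "B * (LINT z|lborel. \<bar>v' z\<bar>)"
      show "integrable lborel (\<lambda>y. ?C * u' y)"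
        using u' by simp
      show "(\<lambda>y. LINT x|lborel. norm (case_prod ?F (y, x))) \<in> borel_measurable lborel"
        by measurable
      have "(LINT x|lborel. \<bar>?F y x\<bar>) \<le> \<bar>?C * u' y\<bar>" for y
      proof -
        have "(LINT x|lborel. \<bar>?F y x\<bar>) \<le> (LINT x|lborel. \<bar>u' y\<bar> * B * \<bar>v' (x - y)\<bar>)"
        proof (rule integral_mono)
          show "integrable lborel (\<lambda>x. \<bar>?F y x\<bar>)"
            using F_int by simp
          show "integrable lborel (\<lambda>x. \<bar>u' y\<bar> * B * \<bar>v' (x - y)\<bar>)"
            using v' integrable_lborel_translation[of "\<lambda>x. \<bar>v' x\<bar>" y] by simp
          show "\<bar>?F y x\<bar> \<le> \<bar>u' y\<bar> * B * \<bar>v' (x - y)\<bar>" for x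
            using mult_left_mono[OF B[of x], of "\<bar>u' y\<bar> * \<bar>v' (x - y)\<bar>"]
            by (simp add: abs_mult mult_ac)
        qed
        also have "\<dots> = \<bar>u' y\<bar> * ?C"
          using integral_lborel_translation[of "\<lambda>x. \<bar>v' x\<bar>" y] by simp
        also have "\<dots> \<le> \<bar>?C * u' y\<bar>"
          using mult_left_mono[OF abs_ge_self[of ?C] abs_ge_zero[of "u' y"]]
          by (simp add: abs_mult mult.commute)
        finally show ?thesis .
      qed
      then show "AE y in lborel. norm (LINT x|lborel. norm (case_prod ?F (y, x)))
          \<le> norm (?C * u' y)"
        by simp
    qed
  qed
  \<comment> \<open>The remaining steps change to the Borel representatives, exchange the integrals, and
    change back.\<close>
  have "(LINT x|lebesgue. convolution u v x * \<phi> x) =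
      (LINT x|lebesgue. LINT y|lborel. ?F y x)"
    by (simp add: convolution_cong_AE[OF _ _ uu' vv'])
  also have "\<dots> = (LINT x|lborel. LINT y|lborel. ?F y x)"
    by (rule integral_completion) measurable
  also have "\<dots> = (LINT y|lborel. LINT x|lborel. ?F y x)"
    by (rule lborel_pair.Fubini_integral[OF F_pair])
  also have "\<dots> = (LINT y|lborel. u' y * (LINT z|lborel. v' z * \<phi> (y + z)))"
    by (simp add: inner)
  also have "\<dots> = (LINT y|lebesgue. u' y * (LINT z|lborel. v' z * \<phi> (y + z)))"
    by (rule integral_completion[symmetric]) measurable
  also have "\<dots> = (LINT y|lebesgue. u y * (LINT z|lebesgue. v z * \<phi> (y + z)))"
  proof -
    have "(LINT z|lborel. v' z * \<phi> (y + z)) = (LINT z|lebesgue. v z * \<phi> (y + z))" for y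
    proof -
      have "(LINT z|lebesgue. v z * \<phi> (y + z)) = (LINT z|lebesgue. v' z * \<phi> (y + z))"
      proof (rule integral_cong_AE)
        show "(\<lambda>z. v z * \<phi> (y + z)) \<in> borel_measurable lebesgue"
          by (rule borel_measurable_integrable, rule integrable_bounded_mult[OF v, where B=B])
            (use B in auto)
        show "(\<lambda>z. v' z * \<phi> (y + z)) \<in> borel_measurable lebesgue"
          by (rule measurable_completion) measurable
        show "AE z in lebesgue. v z * \<phi> (y + z) = v' z * \<phi> (y + z)"
          using AE_completion[OF vv'] by eventually_elim simp
      qed
      then show ?thesis by (simp add: integral_completion)
    qed
    moreover have "(LINT y|lebesgue. u' y * g y) = (LINT y|lebesgue. u y * g y)"
      if [measurable]: "g \<in> borel_measurable borel" for g
    proof (rule integral_cong_AE)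
      show "(\<lambda>y. u' y * g y) \<in> borel_measurable lebesgue"
        by (rule measurable_completion) measurable
      show "(\<lambda>y. u y * g y) \<in> borel_measurable lebesgue"
        using borel_measurable_integrable[OF u] measurable_completion[of g lborel borel]
        by (intro borel_measurable_times) auto
      show "AE y in lebesgue. u' y * g y = u y * g y"
        using AE_completion[OF uu'] by eventually_elim simp
    qed
    moreover have "(\<lambda>y. LINT z|lborel. v' z * \<phi> (y + z)) \<in> borel_measurable borel"
      by measurable
    ultimately show ?thesis by simp
  qed
  finally show ?thesis .
qed

text \<open>Parities form the group of order two, with \<^const>\<open>Even\<close> as zero. In the addition theorem
  for \<open>c\<^sub>p (s + t)\<close>, the term with \<open>c\<^sub>p\<^sub>'\<close> at \<open>s\<close> has at \<open>t\<close> the function whose parity is the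
  difference of \<open>p\<close> and \<open>p'\<close>, which in this group is their sum.\<close>

fun parity_add :: "parity \<Rightarrow> parity \<Rightarrow> parity" where
  "parity_add Even q = q"
| "parity_add Odd Even = Odd"
| "parity_add Odd Odd = Even"

text \<open>The only minus sign in the addition theorems is that of the product of two sines in
  the expansion of \<open>cos (s + t)\<close>.\<close>

fun addition_sign :: "parity \<Rightarrow> parity \<Rightarrow> real" where
  "addition_sign Even Odd = -1"
| "addition_sign _ _ = 1"

lemma parity_trig_add:
  "parity_trig p (s + t) =
     (\<Sum>p'\<in>{Even, Odd}. addition_sign p p' * parity_trig p' s * parity_trig (parity_add p p') t)"
  by (cases p) (simp_all add: cos_add sin_add)

lemma parity_kernel_add:
  "parity_kernel p q r f (y + z) =
     (\<Sum>p'\<in>{Even, Odd}. \<Sum>q'\<in>{Even, Odd}. \<Sum>r'\<in>{Even, Odd}.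
        addition_sign p p' * addition_sign q q' * addition_sign r r' *
        parity_kernel p' q' r' f y *
        parity_kernel (parity_add p p') (parity_add q q') (parity_add r r') f z)"
  \<comment> \<open>The sums stay folded until the addition theorem has been applied in all three
    coordinates.\<close>
  by (simp add: parity_kernel_def distrib_left parity_trig_add del: sum.insert)
    (simp add: algebra_simps)

text \<open>The convolution theorem in real form. Each term of the expanded kernel is a function of
  \<open>y\<close> times a function of \<open>z\<close>, so the double integral splits into a product of a transform of
  \<open>u\<close> and a transform of \<open>v\<close>.\<close>

lemma parity_transform_convolution:
  assumes u: "integrable lebesgue u" and v: "integrable lebesgue v"
  shows "parity_transform p q r (convolution u v) f =
     (\<Sum>p'\<in>{Even, Odd}. \<Sum>q'\<in>{Even, Odd}. \<Sum>r'\<in>{Even, Odd}.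
        addition_sign p p' * addition_sign q q' * addition_sign r r' *
        parity_transform p' q' r' u f *
        parity_transform (parity_add p p') (parity_add q q') (parity_add r r') v f)"
proof -
  let ?\<sigma> = "\<lambda>p' q' r'. addition_sign p p' * addition_sign q q' * addition_sign r r'"
  let ?K' = "\<lambda>p' q' r'. parity_kernel (parity_add p p') (parity_add q q') (parity_add r r') f"
  let ?V = "\<lambda>p' q' r'.
    parity_transform (parity_add p p') (parity_add q q') (parity_add r r') v f"
  have inner: "(LINT z|lebesgue. v z * parity_kernel p q r f (y + z)) =
      (\<Sum>p'\<in>{Even, Odd}. \<Sum>q'\<in>{Even, Odd}. \<Sum>r'\<in>{Even, Odd}.
        ?\<sigma> p' q' r' * parity_kernel p' q' r' f y * ?V p' q' r')" for y
  proof -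
    have "(LINT z|lebesgue. v z * parity_kernel p q r f (y + z)) =
        (LINT z|lebesgue. (\<Sum>p'\<in>{Even, Odd}. \<Sum>q'\<in>{Even, Odd}. \<Sum>r'\<in>{Even, Odd}.
          ?\<sigma> p' q' r' * parity_kernel p' q' r' f y * (v z * ?K' p' q' r' z)))"
      unfolding parity_kernel_add by (simp only: sum_distrib_left mult_ac)
    also have "\<dots> = (\<Sum>p'\<in>{Even, Odd}. \<Sum>q'\<in>{Even, Odd}. \<Sum>r'\<in>{Even, Odd}.
        ?\<sigma> p' q' r' * parity_kernel p' q' r' f y * ?V p' q' r')"
      unfolding parity_transform_def
      by (intro has_bochner_integral_integral_eq has_bochner_integral_mult_right
          has_bochner_integral_sum has_bochner_integral_integrable
          integrable_mult_parity_kernel v)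
    finally show ?thesis .
  qed
  have "parity_transform p q r (convolution u v) f =
      (LINT y|lebesgue. u y * (LINT z|lebesgue. v z * parity_kernel p q r f (y + z)))"
    unfolding parity_transform_def
    by (rule integral_convolution_mult[OF u v _ abs_parity_kernel_le]) measurable
  also have "\<dots> = (LINT y|lebesgue. (\<Sum>p'\<in>{Even, Odd}. \<Sum>q'\<in>{Even, Odd}. \<Sum>r'\<in>{Even, Odd}.
      ?\<sigma> p' q' r' * ((u y * parity_kernel p' q' r' f y) * ?V p' q' r')))"
    unfolding inner by (simp only: sum_distrib_left mult_ac)
  also have "\<dots> = (\<Sum>p'\<in>{Even, Odd}. \<Sum>q'\<in>{Even, Odd}. \<Sum>r'\<in>{Even, Odd}.
      ?\<sigma> p' q' r' * (parity_transform p' q' r' u f * ?V p' q' r'))"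
    unfolding parity_transform_def[of _ _ _ u]
    by (intro has_bochner_integral_integral_eq has_bochner_integral_mult_right
        has_bochner_integral_mult_left
        has_bochner_integral_sum has_bochner_integral_integrable
        integrable_mult_parity_kernel u)
  finally show ?thesis
    by (simp only: mult.assoc)
qed

section \<open>The octonion convolution theorem\<close>

theorem theorem16:
  fixes u v :: "real^3 \<Rightarrow> real"
    and U V :: "real^3 \<Rightarrow> octonion"
    and Uc :: "parity \<Rightarrow> parity \<Rightarrow> parity \<Rightarrow> real^3 \<Rightarrow> real"
  assumes "integrable lebesgue u" and "integrable lebesgue v"
    and "U = oft (\<lambda>x. oct_of_real (u x))"
    and "V = oft (\<lambda>x. oct_of_real (v x))"
    and "\<And>p q r. Uc p q r = oft_part p q r u"
  shows "(\<forall>f. U f =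
             oct_of_real (Uc Even Even Even f)
           - Uc Odd Even Even f *\<^sub>R \<e>\<^sub>1
           - Uc Even Odd Even f *\<^sub>R \<e>\<^sub>2
           + Uc Odd Odd Even f *\<^sub>R \<e>\<^sub>3
           - Uc Even Even Odd f *\<^sub>R \<e>\<^sub>4
           + Uc Odd Even Odd f *\<^sub>R \<e>\<^sub>5
           + Uc Even Odd Odd f *\<^sub>R \<e>\<^sub>6
           - Uc Odd Odd Odd f *\<^sub>R \<e>\<^sub>7)
       \<and> (\<forall>p q r. has_parity p q r (Uc p q r))
       \<and> (\<forall>f. oft (\<lambda>x. oct_of_real (convolution u v x)) f =
             V (vector [f $ 1, f $ 2, f $ 3]) *
               (oct_of_real (Uc Even Even Even f) - Uc Even Even Odd f *\<^sub>R \<e>\<^sub>4)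
           + V (vector [f $ 1, - (f $ 2), - (f $ 3)]) *
               (- (Uc Odd Even Even f *\<^sub>R \<e>\<^sub>1) + Uc Odd Odd Even f *\<^sub>R \<e>\<^sub>3)
           + V (vector [f $ 1, f $ 2, - (f $ 3)]) *
               (- (Uc Even Odd Even f *\<^sub>R \<e>\<^sub>2) + Uc Odd Even Odd f *\<^sub>R \<e>\<^sub>5)
           + V (vector [- (f $ 1), f $ 2, - (f $ 3)]) *
               (Uc Even Odd Odd f *\<^sub>R \<e>\<^sub>6 - Uc Odd Odd Odd f *\<^sub>R \<e>\<^sub>7))"
proof (intro conjI allI)
  have Uc: "Uc p q r = parity_transform p q r u" for p q r
    using assms(1,5) by (simp add: oft_part_eq_parity_transform)
  note octonion_defs = oct_of_real_def oct_e1_def oct_e2_def oct_e3_def oct_e4_def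
    oct_e5_def oct_e6_def oct_e7_def qcnj_def
    times_octonion_def plus_octonion_def minus_octonion_def uminus_octonion_def
    scaleR_octonion_def one_octonion_def
    times_quat_def plus_quat_def minus_quat_def uminus_quat_def scaleR_quat_def
    one_quat_def zero_quat_def
  show "has_parity p q r (Uc p q r)" for p q r
    unfolding Uc by (rule has_parity_parity_transform)
  fix f :: "real^3"
  show "U f =
             oct_of_real (Uc Even Even Even f)
           - Uc Odd Even Even f *\<^sub>R \<e>\<^sub>1
           - Uc Even Odd Even f *\<^sub>R \<e>\<^sub>2
           + Uc Odd Odd Even f *\<^sub>R \<e>\<^sub>3
           - Uc Even Even Odd f *\<^sub>R \<e>\<^sub>4
           + Uc Odd Even Odd f *\<^sub>R \<e>\<^sub>5
           + Uc Even Odd Odd f *\<^sub>R \<e>\<^sub>6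
           - Uc Odd Odd Odd f *\<^sub>R \<e>\<^sub>7"
    unfolding assms(3) Uc oft_eq_parity_transforms by (simp add: octonion_defs)
  \<comment> \<open>Reflecting the frequency multiplies each coordinate of \<open>V\<close> by the sign of its
    parity, so all four values of \<open>V\<close> are expressed by the transforms of \<open>v\<close> at \<open>f\<close>.\<close>
  have V: "V (vector [s1 * f $ 1, s2 * f $ 2, s3 * f $ 3]) =
      (let W = \<lambda>p q r. parity_sign p s1 * parity_sign q s2 * parity_sign r s3 *
                 parity_transform p q r v f
       in Octonion
         (Quat (W Even Even Even) (- W Odd Even Even) (- W Even Odd Even) (W Odd Odd Even))
         (Quat (- W Even Even Odd) (W Odd Even Odd) (W Even Odd Odd) (- W Odd Odd Odd)))"
    if "s1 \<in> {1, -1}" "s2 \<in> {1, -1}" "s3 \<in> {1, -1}" for s1 s2 s3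
  proof -
    have "parity_transform p q r v (vector [s1 * f $ 1, s2 * f $ 2, s3 * f $ 3]) =
        parity_sign p s1 * parity_sign q s2 * parity_sign r s3 * parity_transform p q r v f"
      for p q r
      using has_parity_parity_transform[of p q r v] that unfolding has_parity_def by blast
    then show ?thesis
      unfolding assms(4) oft_eq_parity_transforms Let_def by simp
  qed
  show "oft (\<lambda>x. oct_of_real (convolution u v x)) f =
             V (vector [f $ 1, f $ 2, f $ 3]) *
               (oct_of_real (Uc Even Even Even f) - Uc Even Even Odd f *\<^sub>R \<e>\<^sub>4)
           + V (vector [f $ 1, - (f $ 2), - (f $ 3)]) *
               (- (Uc Odd Even Even f *\<^sub>R \<e>\<^sub>1) + Uc Odd Odd Even f *\<^sub>R \<e>\<^sub>3)
           + V (vector [f $ 1, f $ 2, - (f $ 3)]) *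
               (- (Uc Even Odd Even f *\<^sub>R \<e>\<^sub>2) + Uc Odd Even Odd f *\<^sub>R \<e>\<^sub>5)
           + V (vector [- (f $ 1), f $ 2, - (f $ 3)]) *
               (Uc Even Odd Odd f *\<^sub>R \<e>\<^sub>6 - Uc Odd Odd Odd f *\<^sub>R \<e>\<^sub>7)"
    \<comment> \<open>The four choices of signs are the four arguments of \<open>V\<close> in the formula.\<close>
    using V[of 1 1 1] V[of 1 "-1" "-1"] V[of 1 1 "-1"] V[of "-1" 1 "-1"]
    unfolding Uc oft_eq_parity_transforms
    by (simp add: octonion_defs parity_transform_convolution[OF assms(1,2)] algebra_simps)
qed

end
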